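(* Let $1\le b\le c$ be real numbers, $d\ge1$ an integer, and $$\Delta_{bc}:=\{(\xi,\eta)\in(0,1/b)\times(0,1/c):\ \xi+\eta<1\}.$$ Then, for fixed $(\xi,\eta)\in\Delta_{bc}$ and $\ell\to+\infty$, $$\mathscr K^F_{\ell,b\ell,c\ell,d}\Big(\frac\xi\ell,\frac\eta\ell\Big)=\frac{1+O(1/\ell)}{[D_{bc}(\xi,\eta)\,\pi\ell]^{d/4}},\qquad D_{bc}(\xi,\eta):=\frac{(1-\xi-\eta)(\xi+\eta)}{\xi\eta(1-b\xi)(1-c\eta)} .$$
   Context: Here $\ell$ is a real variable. The Fourier transform $\mathcal F$ is normalized so that $\mathcal F f(k)=(2\pi)^{-d/2}\int_{\mathbb R^d}e^{-ik\cdot x}f(x)\,dx$; for real $a\ge0$, $\|f\|_a:=\|(1+|k|^2)^{a/2}\mathcal F f\|_{L^2(\mathbb R^d)}$ is the norm of the Sobolev space $H^a(\mathbb R^d,\mathbb C)$. For $\sigma,\tau>0$ and real $\ell,m,n\ge 0$, $$\mathscr K^F_{\ell mnd}(\sigma,\tau):=\frac{\|f_{\sigma+\tau,d}\|_\ell}{\|f_{\sigma d}\|_m\|f_{\tau d}\|_n},\qquad f_{\sigma d}(x):=e^{-\sigma|x|^2/2}\ \ (x\in\mathbb R^d).$$ *)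

theory Defs
  imports "HOL-Analysis.Analysis" "HOL-Library.Landau_Symbols"
begin

text \<open>
  The space \<open>\<real>\<^sup>d\<close> is \<^typ>\<open>real ^ 'd\<close>, with \<open>d = CARD('d) \<ge> 1\<close>.
  The transform is the integral formula, hence meaningful for integrable \<open>f\<close>.
\<close>

definition fourier :: "(real ^ 'd \<Rightarrow> complex) \<Rightarrow> real ^ 'd \<Rightarrow> complex" where
  "fourier f k =
     of_real ((2 * pi) powr (- (real CARD('d) / 2))) *
     (LINT x|lebesgue. exp (- (\<i> * of_real (k \<bullet> x))) * f x)"

text \<open>
  Both norms below are real-valued: they are the norms of \<open>L\<^sup>2\<close> and \<open>H\<^sup>a\<close> only on members of
  these spaces, since the Bochner integral of a non-integrable function is \<open>0\<close>.  Gaussians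
  lie in \<open>H\<^sup>a\<close> for every \<open>a\<close>, and are integrable.
\<close>

definition L2_norm_fun :: "(real ^ 'd \<Rightarrow> complex) \<Rightarrow> real" where
  "L2_norm_fun g = sqrt (LINT k|lebesgue. (norm (g k))\<^sup>2)"

definition sobolev_norm :: "real \<Rightarrow> (real ^ 'd \<Rightarrow> complex) \<Rightarrow> real" where
  "sobolev_norm a f =
     L2_norm_fun (\<lambda>k. of_real ((1 + (norm k)\<^sup>2) powr (a / 2)) * fourier f k)"

definition gaussian :: "real \<Rightarrow> real ^ 'd \<Rightarrow> complex" where
  "gaussian \<sigma> x = of_real (exp (- (\<sigma> * (norm x)\<^sup>2 / 2)))"

text \<open>The type argument carries the dimension \<open>d\<close>.\<close>

definition K_F :: "'d::finite itself \<Rightarrow> real \<Rightarrow> real \<Rightarrow> real \<Rightarrow> real \<Rightarrow> real \<Rightarrow> real" where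
  "K_F (_ :: 'd itself) l m n \<sigma> \<tau> =
     sobolev_norm l (gaussian (\<sigma> + \<tau>) :: real ^ 'd \<Rightarrow> complex) /
     (sobolev_norm m (gaussian \<sigma> :: real ^ 'd \<Rightarrow> complex) *
      sobolev_norm n (gaussian \<tau> :: real ^ 'd \<Rightarrow> complex))"

definition Delta :: "real \<Rightarrow> real \<Rightarrow> (real \<times> real) set" where
  "Delta b c = {(\<xi>, \<eta>). (\<xi>, \<eta>) \<in> {0<..<1/b} \<times> {0<..<1/c} \<and> \<xi> + \<eta> < 1}"

definition D :: "real \<Rightarrow> real \<Rightarrow> real \<Rightarrow> real \<Rightarrow> real" where
  "D b c \<xi> \<eta> =
     ((1 - \<xi> - \<eta>) * (\<xi> + \<eta>)) / (\<xi> * \<eta> * (1 - b * \<xi>) * (1 - c * \<eta>))"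

end

theory Submission
  imports Defs "HOL-Probability.Characteristic_Functions"
begin

text \<open>
  The Fourier transform of \<open>exp (- \<sigma> \<bar>x\<bar>\<^sup>2 / 2)\<close> is again a Gaussian, so the square of its norm in
  \<open>H\<^sup>a\<close> is \<open>\<sigma>\<^sup>-\<^sup>d \<integral> (1 + \<bar>k\<bar>\<^sup>2)\<^sup>a exp (- \<bar>k\<bar>\<^sup>2 / \<sigma>) dk\<close>.  With \<open>a = b l\<close> and \<open>\<sigma> = \<xi> / l\<close>
  the integrand is \<open>exp (- l \<phi> (k))\<close>, where \<open>\<phi> (k) = \<bar>k\<bar>\<^sup>2 / \<xi> - b ln (1 + \<bar>k\<bar>\<^sup>2)\<close>.  Since
  \<open>b \<xi> < 1\<close>, this phase has its only minimum at \<open>k = 0\<close>, with quadratic part \<open>\<alpha> \<bar>k\<bar>\<^sup>2\<close>,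
  \<open>\<alpha> = 1 / \<xi> - b > 0\<close>, so that by Laplace's method the integral behaves like \<open>(\<pi> / (l \<alpha>))\<^bsup>d/2\<^esup>\<close>.

  The error can be controlled by elementary means.  For \<open>t \<ge> 0\<close>,
  \<open>t - t\<^sup>2 \<le> ln (1 + t) \<le> t\<close>; hence \<open>exp (- l \<phi>)\<close> lies below the Gaussian \<open>exp (- l \<alpha> \<bar>k\<bar>\<^sup>2)\<close> and
  above this Gaussian times \<open>1 - b l \<bar>k\<bar>\<^sup>4\<close>.  The fourth moment of the Gaussian is smaller
  than its integral by a factor of order \<open>l\<^sup>-\<^sup>2\<close>, so the relative error is of order \<open>1 / l\<close>
  (\<open>weighted_gaussian_integral_bounds\<close>).

  Each of the three norms in \<open>K_F\<close> thus equals an explicit power of \<open>l\<close> times a factor between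
  \<open>1 - C / l\<close> and \<open>1\<close> (\<open>sobolev_norm_gaussian_bounds\<close>).  The numerator is the case of weight
  \<open>b = 1\<close> and parameter \<open>\<xi> + \<eta>\<close>, and the quotient of the three explicit powers is
  \<open>(D b c \<xi> \<eta> \<pi> l)\<^bsup>-d/4\<^esup>\<close>.
\<close>

section \<open>Gaussian integrals\<close>

text \<open>
  The substitution \<open>x \<mapsto> x / sqrt \<sigma>\<close> reduces this to the characteristic function of the standard
  normal distribution.
\<close>

lemma gaussian_fourier_integral_real:
  fixes \<sigma> k :: real
  assumes "\<sigma> > 0"
  shows "has_bochner_integral lborel
           (\<lambda>x. exp (- (\<i> * of_real (k * x))) * complex_of_real (exp (- (\<sigma> * x\<^sup>2 / 2))))
           (of_real (sqrt (2 * pi / \<sigma>) * exp (- (k\<^sup>2 / (2 * \<sigma>)))))"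
proof -
  define f where "f = (\<lambda>x. exp (- (\<i> * of_real (k * x))) * complex_of_real (exp (- (\<sigma> * x\<^sup>2 / 2))))"
  define s where "s = 1 / sqrt \<sigma>"
  define g where "g = (\<lambda>x. complex_of_real (std_normal_density x) * iexp (- (k * s) * x))"
  have s: "s > 0" "\<sigma> * s\<^sup>2 = 1"
    using assms by (auto simp: s_def power_divide)
  have sq: "\<sigma> * (s * x)\<^sup>2 = x\<^sup>2" for x
    by (simp only: power_mult_distrib mult.assoc[symmetric] s(2) mult_1)
  have fg: "f (0 + s * x) = of_real (sqrt (2 * pi)) * g x" for x
    unfolding f_def g_def std_normal_density_def add_0 sq by (simp add: mult_ac)
  have "integrable lborel std_normal_density"
    by simp
  moreover have "norm (g x) = norm (std_normal_density x)" for x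
    by (simp add: g_def norm_mult)
  moreover have "g \<in> borel_measurable lborel"
    unfolding g_def by measurable
  ultimately have g_int: "integrable lborel g"
    by (metis (no_types, lifting) AE_I2 Bochner_Integration.integrable_bound order_refl)
  have "char std_normal_distribution (- (k * s)) = integral\<^sup>L lborel g"
    unfolding char_def g_def
    by (subst integral_density) (auto simp: scaleR_conv_of_real)
  then have g_val: "integral\<^sup>L lborel g = of_real (exp (- ((k * s)\<^sup>2) / 2))"
    by (simp add: char_std_normal_distribution)
  have "has_bochner_integral lborel (\<lambda>x. f (0 + s * x))
          (of_real (sqrt (2 * pi)) * of_real (exp (- ((k * s)\<^sup>2) / 2)))"
    unfolding fg using g_int g_val
    by (intro has_bochner_integral_mult_right) (simp add: has_bochner_integral_iff)
  moreover have "of_real (sqrt (2 * pi)) * of_real (exp (- ((k * s)\<^sup>2) / 2))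
      = (of_real (sqrt (2 * pi / \<sigma>) * exp (- (k\<^sup>2 / (2 * \<sigma>)))) :: complex) /\<^sub>R \<bar>s\<bar>"
    using assms s(1)
    by (simp add: s_def real_sqrt_divide power_mult_distrib power_divide scaleR_conv_of_real)
  ultimately show ?thesis
    using s(1) lborel_has_bochner_integral_real_affine_iff[of s f _ 0]
    by (simp add: f_def)
qed

text \<open>
  Fubini's theorem for a product of functions of one coordinate each; it reduces Gaussian
  integrals in any dimension to dimension one.
\<close>

lemma has_bochner_integral_lborel_prod:
  fixes f :: "'a::euclidean_space \<Rightarrow> real \<Rightarrow> 'b::{real_normed_field,banach,second_countable_topology}"
  assumes "\<And>b. b \<in> Basis \<Longrightarrow> has_bochner_integral lborel (f b) (I b)"
  shows "has_bochner_integral lborel (\<lambda>x. \<Prod>b\<in>Basis. f b (x \<bullet> b)) (\<Prod>b\<in>Basis. I b)"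
proof -
  interpret product_sigma_finite "\<lambda>_::'a. lborel :: real measure"
    by unfold_locales
  have int: "integrable lborel (f b)" and val: "integral\<^sup>L lborel (f b) = I b" if "b \<in> Basis" for b
    using assms[OF that] by (auto simp: has_bochner_integral_iff)
  have [measurable]: "f b \<in> borel_measurable borel" if "b \<in> Basis" for b
    using int[OF that] by auto
  have "has_bochner_integral (\<Pi>\<^sub>M b\<in>Basis. lborel) (\<lambda>y. \<Prod>b\<in>Basis. f b (y b)) (\<Prod>b\<in>Basis. I b)"
    using product_integrable_prod[of Basis f] product_integral_prod[of Basis f] int val
    by (simp add: has_bochner_integral_iff)
  then have "has_bochner_integral (\<Pi>\<^sub>M b\<in>Basis. lborel)
      (\<lambda>y. \<Prod>b\<in>Basis. f b ((\<Sum>b\<in>Basis. y b *\<^sub>R b) \<bullet> b)) (\<Prod>b\<in>Basis. I b)"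
    by simp
  then show ?thesis
    by (subst lborel_eq, subst has_bochner_integral_distr) simp_all
qed

lemma gaussian_fourier_integral:
  fixes k :: "'a::euclidean_space"
  assumes "\<sigma> > 0"
  shows "has_bochner_integral lborel
           (\<lambda>x. exp (- (\<i> * of_real (k \<bullet> x))) * complex_of_real (exp (- (\<sigma> * (norm x)\<^sup>2 / 2))))
           (of_real ((2 * pi / \<sigma>) powr (DIM('a) / 2) * exp (- ((norm k)\<^sup>2 / (2 * \<sigma>)))))"
proof -
  have norm_sq: "(norm y)\<^sup>2 = (\<Sum>b\<in>Basis. (y \<bullet> b)\<^sup>2)" for y :: 'a
    by (simp only: power2_norm_eq_inner) (subst euclidean_inner, simp add: power2_eq_square)
  define f where "f = (\<lambda>b t. exp (- (\<i> * of_real ((k \<bullet> b) * t))) *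
                           complex_of_real (exp (- (\<sigma> * t\<^sup>2 / 2))))"
  define I where "I = (\<lambda>b. complex_of_real (sqrt (2 * pi / \<sigma>) * exp (- ((k \<bullet> b)\<^sup>2 / (2 * \<sigma>)))))"
  have "has_bochner_integral lborel (\<lambda>x::'a. \<Prod>b\<in>Basis. f b (x \<bullet> b)) (\<Prod>b\<in>Basis. I b)"
    unfolding f_def I_def
    by (intro has_bochner_integral_lborel_prod gaussian_fourier_integral_real assms)
  moreover have "(\<Prod>b\<in>Basis. f b (x \<bullet> b)) =
      exp (- (\<i> * of_real (k \<bullet> x))) * complex_of_real (exp (- (\<sigma> * (norm x)\<^sup>2 / 2)))" for x
    unfolding f_def prod.distrib norm_sq euclidean_inner[of k x]
    by (simp add: exp_sum sum_distrib_left sum_divide_distrib sum_negf [symmetric])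
  moreover have "(\<Prod>b\<in>Basis. I b) =
      of_real ((2 * pi / \<sigma>) powr (DIM('a) / 2) * exp (- ((norm k)\<^sup>2 / (2 * \<sigma>))))"
  proof -
    have "sqrt (2 * pi / \<sigma>) ^ DIM('a) = (2 * pi / \<sigma>) powr (DIM('a) / 2)"
      using assms by (simp add: powr_half_sqrt [symmetric] powr_realpow [symmetric] powr_powr)
    then show ?thesis
      unfolding I_def of_real_prod [symmetric] prod.distrib norm_sq
      by (simp add: exp_sum sum_divide_distrib sum_negf [symmetric])
  qed
  ultimately show ?thesis
    by simp
qed

lemma gaussian_integral:
  assumes "\<alpha> > 0"
  shows "has_bochner_integral lborel (\<lambda>x::'a::euclidean_space. exp (- (\<alpha> * (norm x)\<^sup>2)))
           ((pi / \<alpha>) powr (DIM('a) / 2))"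
proof -
  have "has_bochner_integral lborel
          (\<lambda>x::'a. complex_of_real (exp (- (\<alpha> * (norm x)\<^sup>2)))) (of_real ((pi / \<alpha>) powr (DIM('a) / 2)))"
    using gaussian_fourier_integral[of "2 * \<alpha>" "0::'a"] assms by simp
  then show ?thesis
    using has_bochner_integral_Re by fastforce
qed

section \<open>Sobolev norms of Gaussians\<close>

lemma fourier_gaussian:
  fixes k :: "real ^ 'd"
  assumes "\<sigma> > 0"
  shows "fourier (gaussian \<sigma>) k
           = of_real (\<sigma> powr (- (CARD('d) / 2)) * exp (- ((norm k)\<^sup>2 / (2 * \<sigma>))))"
proof -
  have "(LINT x|lebesgue. exp (- (\<i> * of_real (k \<bullet> x))) * gaussian \<sigma> x)
      = of_real ((2 * pi / \<sigma>) powr (CARD('d) / 2) * exp (- ((norm k)\<^sup>2 / (2 * \<sigma>))))"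
    using gaussian_fourier_integral[OF assms, of k]
    by (subst integral_completion) (auto simp: gaussian_def[abs_def] has_bochner_integral_iff)
  moreover have "(2 * pi) powr (- (real CARD('d) / 2)) * (2 * pi / \<sigma>) powr (CARD('d) / 2)
      = \<sigma> powr (- (CARD('d) / 2))"
    using assms by (simp add: powr_divide powr_minus powr_mult field_simps)
  ultimately show ?thesis
    unfolding fourier_def by (simp flip: of_real_mult add: mult.assoc [symmetric])
qed

lemma sobolev_norm_gaussian:
  assumes "\<sigma> > 0"
  shows "sobolev_norm a (gaussian \<sigma> :: real ^ 'd \<Rightarrow> complex)
           = sqrt (\<sigma> powr (- CARD('d)) *
               (LINT k::real^'d|lborel. (1 + (norm k)\<^sup>2) powr a * exp (- ((norm k)\<^sup>2 / \<sigma>))))"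
proof -
  have pos: "1 + (norm k)\<^sup>2 > 0" for k :: "real ^ 'd"
    by (simp add: add_pos_nonneg)
  have "(norm (of_real ((1 + (norm k)\<^sup>2) powr (a / 2)) * fourier (gaussian \<sigma>) k))\<^sup>2
      = \<sigma> powr (- CARD('d)) * ((1 + (norm k)\<^sup>2) powr a * exp (- ((norm k)\<^sup>2 / \<sigma>)))" (is "?l = ?r")
    for k :: "real ^ 'd"
  proof -
    have "?l = ((1 + (norm k)\<^sup>2) powr (a / 2))\<^sup>2 * (\<sigma> powr (- (CARD('d) / 2)))\<^sup>2
               * (exp (- ((norm k)\<^sup>2 / (2 * \<sigma>))))\<^sup>2"
      using assms by (simp add: fourier_gaussian norm_mult power_mult_distrib)
    also have "\<dots> = ?r"
      using pos[of k] assms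
      by (simp add: powr_realpow [symmetric] powr_powr exp_of_nat_mult [symmetric] mult_ac
               flip: exp_double)
    finally show ?thesis .
  qed
  then show ?thesis
    unfolding sobolev_norm_def L2_norm_fun_def
    by (simp add: integral_completion)
qed

section \<open>Laplace asymptotics of the weighted Gaussian integral\<close>

text \<open>
  Giving up half of the decay rate absorbs the factor \<open>t\<^sup>2\<close>.  With \<open>t = \<bar>k\<bar>\<^sup>2\<close> this bounds the
  fourth moment of a Gaussian by the integral of a wider Gaussian, with the correct power of
  \<open>\<beta>\<close>, so that the moment itself need not be computed.
\<close>

lemma sq_exp_le:
  fixes \<beta> t :: real
  assumes "\<beta> > 0" "t \<ge> 0"
  shows "t\<^sup>2 * exp (- (2 * \<beta> * t)) \<le> 2 / \<beta>\<^sup>2 * exp (- (\<beta> * t))"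
proof -
  have "1 + \<beta> * t + (\<beta> * t)\<^sup>2 / 2 \<le> exp (\<beta> * t)"
    using assms by (intro exp_lower_Taylor_quadratic) simp
  then have "(\<beta> * t)\<^sup>2 / 2 \<le> exp (\<beta> * t)"
    using assms by (smt (verit) mult_nonneg_nonneg)
  then have "t\<^sup>2 \<le> 2 / \<beta>\<^sup>2 * exp (\<beta> * t)"
    using assms by (simp add: field_simps)
  then have "t\<^sup>2 * exp (- (2 * \<beta> * t)) \<le> 2 / \<beta>\<^sup>2 * exp (\<beta> * t) * exp (- (2 * \<beta> * t))"
    by (intro mult_right_mono) auto
  then show ?thesis
    by (simp add: mult.assoc exp_add [symmetric])
qed

text \<open>
  The function in question is \<open>exp (- p (t - ln (1 + t)))\<close>, and \<open>0 \<le> t - ln (1 + t) \<le> t\<^sup>2\<close>.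
  The sharp upper bound is \<open>t\<^sup>2 / 2\<close>, but the constant only affects the constant of the error term.
\<close>

lemma one_plus_powr_exp_bounds:
  fixes p t :: real
  assumes "p \<ge> 0" "t \<ge> 0"
  shows "(1 + t) powr p * exp (- (p * t)) \<le> 1"
    and "1 - p * t\<^sup>2 \<le> (1 + t) powr p * exp (- (p * t))"
proof -
  have eq: "(1 + t) powr p * exp (- (p * t)) = exp (- (p * (t - ln (1 + t))))"
    using assms by (simp add: powr_def exp_add [symmetric] algebra_simps)
  have "ln (1 + t) \<le> t"
    using assms by (intro ln_add_one_self_le_self) auto
  then show "(1 + t) powr p * exp (- (p * t)) \<le> 1"
    using assms unfolding eq by simp
  have "t - t\<^sup>2 \<le> ln (1 + t)"
  proof (cases "t \<le> 1")
    case True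
    then show ?thesis using assms by (intro ln_one_plus_pos_lower_bound) auto
  next
    case False
    then have "t \<le> t\<^sup>2" "0 \<le> ln (1 + t)"
      by (auto simp: power2_eq_square)
    then show ?thesis by simp
  qed
  then have "p * (t - ln (1 + t)) \<le> p * t\<^sup>2"
    using assms by (intro mult_left_mono) auto
  then show "1 - p * t\<^sup>2 \<le> (1 + t) powr p * exp (- (p * t))"
    unfolding eq using exp_ge_add_one_self[of "- (p * (t - ln (1 + t)))"] by linarith
qed

text \<open>
  Laplace's method with explicit error.  When \<open>p\<close> and \<open>\<gamma>\<close> are proportional to a large
  parameter \<open>l\<close>, the relative error, a multiple of \<open>p / \<gamma>\<^sup>2\<close>, is of order \<open>1 / l\<close>.  The weight \<open>(1 + \<bar>k\<bar>\<^sup>2)\<^sup>p\<close> is paired with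
  \<open>exp (- p \<bar>k\<bar>\<^sup>2)\<close>, which cancels it to first order at \<open>k = 0\<close>; what is left is close to the
  Gaussian \<open>G\<close> of rate \<open>\<gamma>\<close>, and the wider Gaussian \<open>H\<close> of rate \<open>\<gamma> / 2\<close> dominates the
  fourth-order error.  The factor \<open>2 powr d\<close> is the quotient of the integrals of \<open>H\<close> and \<open>G\<close>.
\<close>

lemma weighted_gaussian_integral_bounds:
  fixes p \<gamma> :: real
  assumes "p \<ge> 0" "\<gamma> > 0"
  defines "d \<equiv> real DIM('a::euclidean_space) / 2"
  defines "I \<equiv> LINT k::'a|lborel. (1 + (norm k)\<^sup>2) powr p * exp (- ((\<gamma> + p) * (norm k)\<^sup>2))"
  shows "I \<le> (pi / \<gamma>) powr d"
    and "(1 - 8 * 2 powr d * p / \<gamma>\<^sup>2) * (pi / \<gamma>) powr d \<le> I"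
proof -
  define G where "G = (\<lambda>k::'a. exp (- (\<gamma> * (norm k)\<^sup>2)))"
  define H where "H = (\<lambda>k::'a. exp (- (\<gamma> / 2 * (norm k)\<^sup>2)))"
  define F where "F = (\<lambda>k::'a. (1 + (norm k)\<^sup>2) powr p * exp (- ((\<gamma> + p) * (norm k)\<^sup>2)))"
  have G: "integrable lborel G" "integral\<^sup>L lborel G = (pi / \<gamma>) powr d"
    using gaussian_integral[of \<gamma>, where 'a='a] assms
    by (auto simp: G_def d_def has_bochner_integral_iff)
  have "pi / (\<gamma> / 2) = 2 * (pi / \<gamma>)"
    by simp
  then have H: "integrable lborel H" "integral\<^sup>L lborel H = 2 powr d * (pi / \<gamma>) powr d"
    using gaussian_integral[of "\<gamma> / 2", where 'a='a] assms
    by (auto simp: H_def d_def has_bochner_integral_iff powr_mult powr_divide)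
  have F_eq: "F k = ((1 + (norm k)\<^sup>2) powr p * exp (- (p * (norm k)\<^sup>2))) * G k" for k
    by (simp add: F_def G_def mult.assoc exp_add [symmetric] algebra_simps)
  have upper: "F k \<le> G k" for k
    using mult_right_mono[OF one_plus_powr_exp_bounds(1)[OF assms(1)], of "(norm k)\<^sup>2" "G k"]
    unfolding F_eq by (simp add: G_def)
  have lower: "G k - 8 * p / \<gamma>\<^sup>2 * H k \<le> F k" for k
  proof -
    have "p * (((norm k)\<^sup>2)\<^sup>2 * G k) \<le> p * (8 / \<gamma>\<^sup>2 * H k)"
      using assms sq_exp_le[of "\<gamma> / 2" "(norm k)\<^sup>2"]
      by (intro mult_left_mono) (auto simp: G_def H_def power_divide)
    moreover have "(1 - p * ((norm k)\<^sup>2)\<^sup>2) * G k \<le> F k"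
      unfolding F_eq using assms
      by (intro mult_right_mono one_plus_powr_exp_bounds) (auto simp: G_def)
    ultimately show ?thesis
      by (simp add: algebra_simps)
  qed
  have F: "integrable lborel F"
  proof (rule Bochner_Integration.integrable_bound[OF G(1)])
    show "F \<in> borel_measurable lborel"
      unfolding F_def by measurable
    have "F k \<ge> 0" "G k \<ge> 0" for k
      by (auto simp: F_def G_def)
    then show "AE k in lborel. norm (F k) \<le> norm (G k)"
      using upper by simp
  qed
  have I: "I = integral\<^sup>L lborel F"
    by (simp add: I_def F_def)
  show "I \<le> (pi / \<gamma>) powr d"
    unfolding I G(2) [symmetric] by (intro integral_mono F G upper)
  have "(LINT k|lborel. G k - 8 * p / \<gamma>\<^sup>2 * H k) \<le> I"
    unfolding I by (intro integral_mono F G(1) H(1) lower Bochner_Integration.integrable_diff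
        Bochner_Integration.integrable_mult_right)
  then show "(1 - 8 * 2 powr d * p / \<gamma>\<^sup>2) * (pi / \<gamma>) powr d \<le> I"
    using G H by (simp add: algebra_simps)
qed

text \<open>
  The Laplace bounds with \<open>p = b l\<close> and \<open>\<gamma> = l \<alpha>\<close>, \<open>\<alpha> = 1 / \<xi> - b\<close>.  They concern the square
  of the norm, but a number in \<open>[0, 1]\<close> is at most its square root, so the lower bound passes
  to the norm with the same constant.
\<close>

lemma sobolev_norm_gaussian_bounds:
  fixes b \<xi> :: real
  assumes "b \<ge> 0" "\<xi> > 0" "b * \<xi> < 1"
  obtains C where "C \<ge> 0"
    "\<And>l. l > 0 \<Longrightarrow> 1 - C / l \<le> sobolev_norm (b * l) (gaussian (\<xi> / l) :: real ^ 'd \<Rightarrow> complex)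
                            / (pi * l / (\<xi> * (1 - b * \<xi>))) powr (CARD('d) / 4)"
    "\<And>l. l > 0 \<Longrightarrow> sobolev_norm (b * l) (gaussian (\<xi> / l) :: real ^ 'd \<Rightarrow> complex)
                            / (pi * l / (\<xi> * (1 - b * \<xi>))) powr (CARD('d) / 4) \<le> 1"
proof -
  define \<alpha> where "\<alpha> = 1 / \<xi> - b"
  define d where "d = real CARD('d) / 2"
  define C where "C = 8 * 2 powr d * b / \<alpha>\<^sup>2"
  have \<alpha>: "\<alpha> > 0"
    using assms by (simp add: \<alpha>_def field_simps)
  have "1 - C / l \<le> N \<and> N \<le> 1"
    if l: "l > 0" and N: "N = sobolev_norm (b * l) (gaussian (\<xi> / l) :: real ^ 'd \<Rightarrow> complex)
                            / (pi * l / (\<xi> * (1 - b * \<xi>))) powr (CARD('d) / 4)" for l N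
  proof -
    define I where "I = (LINT k::real^'d|lborel. (1 + (norm k)\<^sup>2) powr (b * l)
                            * exp (- ((l * \<alpha> + b * l) * (norm k)\<^sup>2)))"
    define M where "M = (pi / (l * \<alpha>)) powr d"
    have M: "M > 0"
      using l \<alpha> by (simp add: M_def)
    have "b * l \<ge> 0" "l * \<alpha> > 0"
      using l \<alpha> assms by auto
    from weighted_gaussian_integral_bounds[OF this, where 'a="real^'d"]
    have I: "I \<le> M" "(1 - 8 * 2 powr d * (b * l) / (l * \<alpha>)\<^sup>2) * M \<le> I"
      by (simp_all add: I_def M_def d_def)
    have "8 * 2 powr d * (b * l) / (l * \<alpha>)\<^sup>2 = C / l"
      using l by (simp add: C_def power2_eq_square mult_ac)
    then have ratio: "I / M \<le> 1" "1 - C / l \<le> I / M"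
      using M I by (simp_all only: pos_divide_le_eq pos_le_divide_eq mult_1)
    have I_nonneg: "I \<ge> 0"
      unfolding I_def by (intro integral_nonneg_AE) auto
    have "(norm k)\<^sup>2 / (\<xi> / l) = (l * \<alpha> + b * l) * (norm k)\<^sup>2" for k :: "real ^ 'd"
      using assms l by (simp add: \<alpha>_def field_simps)
    then have norm_eq: "sobolev_norm (b * l) (gaussian (\<xi> / l) :: real ^ 'd \<Rightarrow> complex)
        = sqrt ((\<xi> / l) powr (- CARD('d)) * I)"
      using assms l by (simp add: sobolev_norm_gaussian I_def)
    have "1 - b * \<xi> = \<xi> * \<alpha>"
      using assms by (simp add: \<alpha>_def right_diff_distrib)
    then have "pi * l / (\<xi> * (1 - b * \<xi>)) = (\<xi> / l) powr (- 2) * (pi / (l * \<alpha>))"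
      using assms l by (simp add: powr_minus_divide power2_eq_square)
    moreover have "2 * d = CARD('d)"
      by (simp add: d_def)
    ultimately have "(pi * l / (\<xi> * (1 - b * \<xi>))) powr d = (\<xi> / l) powr (- CARD('d)) * M"
      using assms l \<alpha> by (simp add: powr_mult powr_powr M_def del: times_divide_eq_right)
    moreover have "(pi * l / (\<xi> * (1 - b * \<xi>))) powr (CARD('d) / 4)
        = sqrt ((pi * l / (\<xi> * (1 - b * \<xi>))) powr d)"
      using powr_half_sqrt_powr[of "pi * l / (\<xi> * (1 - b * \<xi>))" d] assms l
      by (simp add: d_def)
    ultimately have "N = sqrt ((\<xi> / l) powr (- CARD('d)) * I) / sqrt ((\<xi> / l) powr (- CARD('d)) * M)"
      unfolding N norm_eq by simp
    moreover have "(\<xi> / l) powr (- CARD('d)) > 0"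
      using assms l by simp
    ultimately have N_eq: "N = sqrt (I / M)"
      by (simp add: real_sqrt_mult real_sqrt_divide)
    have "(I / M)\<^sup>2 \<le> I / M"
      using mult_left_le[of "I / M" "I / M"] ratio M I_nonneg
      by (simp only: power2_eq_square) simp
    then have "I / M \<le> N"
      unfolding N_eq by (rule real_le_rsqrt)
    then show ?thesis
      using ratio unfolding N_eq by simp
  qed
  then show ?thesis
    using that[of C] assms by (auto simp: C_def)
qed

section \<open>The quotient of norms\<close>

text \<open>
  This is where three errors of order \<open>1 / l\<close> combine into one.  The bounds \<open>1 / 4\<close> keep the
  denominator \<open>v w\<close> above \<open>1 / 2\<close>, whence the factor 2.
\<close>

lemma quotient_deviation_bound:
  fixes u v w :: real
  assumes "u \<le> 1" "v \<le> 1" "w \<le> 1" "1 - x \<le> u" "1 - y \<le> v" "1 - z \<le> w"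
    and "0 \<le> x" "0 \<le> y" "y \<le> 1/4" "0 \<le> z" "z \<le> 1/4"
  shows "\<bar>u / (v * w) - 1\<bar> \<le> 2 * (x + y + z)"
proof -
  have "(1 - y) * (1 - z) \<le> v * w"
    using assms by (intro mult_mono) auto
  then have vw: "1 - y - z \<le> v * w"
    using mult_nonneg_nonneg[OF \<open>0 \<le> y\<close> \<open>0 \<le> z\<close>] by (simp add: algebra_simps)
  have "v * w \<le> 1"
    using assms by (intro mult_le_one) auto
  with vw have "\<bar>u - v * w\<bar> \<le> x + y + z" "v * w \<ge> 1 / 2"
    using assms by linarith+
  then have "\<bar>u - v * w\<bar> / (v * w) \<le> (x + y + z) / (1 / 2)"
    using assms by (intro frac_le) auto
  moreover have "u / (v * w) - 1 = (u - v * w) / (v * w)"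
    unfolding diff_divide_distrib using \<open>v * w \<ge> 1 / 2\<close> by (subst divide_self) auto
  then have "\<bar>u / (v * w) - 1\<bar> = \<bar>u - v * w\<bar> / (v * w)"
    using \<open>v * w \<ge> 1 / 2\<close> by (simp only: abs_divide)
  ultimately show ?thesis
    by simp
qed

theorem proposition4p7:
  fixes b c \<xi> \<eta> :: real
  assumes "1 \<le> b" and "b \<le> c"
    and "(\<xi>, \<eta>) \<in> Delta b c"
  shows "\<exists>\<epsilon> \<in> O[at_top](\<lambda>l::real. 1 / l).
           \<forall>\<^sub>F l in at_top.
             K_F TYPE('d::finite) l (b * l) (c * l) (\<xi> / l) (\<eta> / l) =
               (1 + \<epsilon> l) / (D b c \<xi> \<eta> * pi * l) powr (real CARD('d) / 4)"
proof -
  have pos: "\<xi> > 0" "\<eta> > 0" "b * \<xi> < 1" "c * \<eta> < 1" "\<xi> + \<eta> < 1"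
    using assms by (auto simp: Delta_def field_simps)
  define d where "d = real CARD('d) / 4"
  define S where "S = (\<lambda>a \<zeta> l. sobolev_norm (a * l) (gaussian (\<zeta> / l) :: real ^ 'd \<Rightarrow> complex))"
  define A where "A = (\<lambda>a \<zeta> l. (pi * l / (\<zeta> * (1 - a * \<zeta>))) powr d)"
  define N where "N = (\<lambda>a \<zeta> l. S a \<zeta> l / A a \<zeta> l)"
  obtain C0 where C0: "C0 \<ge> 0" "\<And>l. l > 0 \<Longrightarrow> 1 - C0 / l \<le> N 1 (\<xi> + \<eta>) l"
      "\<And>l. l > 0 \<Longrightarrow> N 1 (\<xi> + \<eta>) l \<le> 1"
    using sobolev_norm_gaussian_bounds[of 1 "\<xi> + \<eta>", where 'd='d] pos
    unfolding N_def S_def A_def d_def by auto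
  obtain C1 where C1: "C1 \<ge> 0" "\<And>l. l > 0 \<Longrightarrow> 1 - C1 / l \<le> N b \<xi> l" "\<And>l. l > 0 \<Longrightarrow> N b \<xi> l \<le> 1"
    using sobolev_norm_gaussian_bounds[of b \<xi>, where 'd='d] pos assms
    unfolding N_def S_def A_def d_def by auto
  obtain C2 where C2: "C2 \<ge> 0" "\<And>l. l > 0 \<Longrightarrow> 1 - C2 / l \<le> N c \<eta> l" "\<And>l. l > 0 \<Longrightarrow> N c \<eta> l \<le> 1"
    using sobolev_norm_gaussian_bounds[of c \<eta>, where 'd='d] pos assms
    unfolding N_def S_def A_def d_def by auto
  \<comment> \<open>The prefactors \<open>A\<close> combine exactly to the claimed power of \<open>D b c \<xi> \<eta> * pi * l\<close>, so the
    relative error comes from the normalised norms \<open>N\<close> alone.\<close>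
  define \<epsilon> where "\<epsilon> = (\<lambda>l. N 1 (\<xi> + \<eta>) l / (N b \<xi> l * N c \<eta> l) - 1)"
  have "\<epsilon> \<in> O[at_top](\<lambda>l. 1 / l)"
  proof (rule bigoI)
    show "\<forall>\<^sub>F l in at_top. norm (\<epsilon> l) \<le> 2 * (C0 + C1 + C2) * norm (1 / l)"
      using eventually_gt_at_top[of 0] eventually_ge_at_top[of "4 * C1"]
        eventually_ge_at_top[of "4 * C2"]
    proof eventually_elim
      case (elim l)
      then have "\<bar>\<epsilon> l\<bar> \<le> 2 * (C0 / l + C1 / l + C2 / l)"
        unfolding \<epsilon>_def using C0 C1 C2
        by (intro quotient_deviation_bound) (auto simp: field_simps)
      then show ?case
        using elim by (simp add: add_divide_distrib)
    qed
  qed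
  moreover have "\<forall>\<^sub>F l in at_top. K_F TYPE('d) l (b * l) (c * l) (\<xi> / l) (\<eta> / l)
      = (1 + \<epsilon> l) / (D b c \<xi> \<eta> * pi * l) powr (real CARD('d) / 4)"
    using eventually_gt_at_top[of 0]
  proof eventually_elim
    case (elim l)
    have A_pos: "A 1 (\<xi> + \<eta>) l > 0" "A b \<xi> l > 0" "A c \<eta> l > 0"
      using pos elim by (auto simp: A_def)
    have "A b \<xi> l * A c \<eta> l / A 1 (\<xi> + \<eta>) l
        = ((pi * l / (\<xi> * (1 - b * \<xi>))) * (pi * l / (\<eta> * (1 - c * \<eta>)))
            / (pi * l / ((\<xi> + \<eta>) * (1 - 1 * (\<xi> + \<eta>))))) powr d"
      using pos elim unfolding A_def by (simp add: powr_mult powr_divide)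
    also have "(pi * l / (\<xi> * (1 - b * \<xi>))) * (pi * l / (\<eta> * (1 - c * \<eta>)))
            / (pi * l / ((\<xi> + \<eta>) * (1 - 1 * (\<xi> + \<eta>)))) = D b c \<xi> \<eta> * pi * l"
      using elim by (simp add: D_def mult_ac diff_diff_eq)
    finally have "1 / (D b c \<xi> \<eta> * pi * l) powr d = A 1 (\<xi> + \<eta>) l / (A b \<xi> l * A c \<eta> l)"
      by (metis inverse_divide inverse_eq_divide)
    moreover have "K_F TYPE('d) l (b * l) (c * l) (\<xi> / l) (\<eta> / l)
        = S 1 (\<xi> + \<eta>) l / (S b \<xi> l * S c \<eta> l)"
      by (simp add: K_F_def S_def add_divide_distrib)
    moreover have "S 1 (\<xi> + \<eta>) l / (S b \<xi> l * S c \<eta> l)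
        = (1 + \<epsilon> l) * (A 1 (\<xi> + \<eta>) l / (A b \<xi> l * A c \<eta> l))"
      using A_pos by (simp add: \<epsilon>_def N_def)
    ultimately show ?case
      by (simp add: d_def) (metis mult.right_neutral times_divide_eq_right)
  qed
  ultimately show ?thesis
    by blast
qed

end
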